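(* There exist no semi-equivelar maps of types $(3^4,8)$, $(3^2,4,3,6)$, $(3,6,4,6)$, $(4^3,6)$ or $(4,8,12)$ on the closed surface of Euler characteristic $-1$. *)

theory Defs
  imports Main
begin

text \<open>Combinatorial (polyhedral) maps on closed surfaces.
  A map is a finite set of faces; each face is a cyclic list of distinct vertices
  (length at least 3). Edges are 2-element vertex sets of cyclically consecutive vertices.\<close>

definition face_edges :: "'a list \<Rightarrow> 'a set set" where
  "face_edges f = {{f ! i, f ! ((i + 1) mod length f)} | i. i < length f}"

definition map_verts :: "'a list set \<Rightarrow> 'a set" where
  "map_verts M = \<Union> (set ` M)"

definition map_edges :: "'a list set \<Rightarrow> 'a set set" where
  "map_edges M = \<Union> (face_edges ` M)"

definition face_cycle :: "'a list set \<Rightarrow> 'a \<Rightarrow> 'a list list \<Rightarrow> bool" where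
  "face_cycle M v fs \<longleftrightarrow>
     distinct fs \<and> length fs \<ge> 3 \<and> set fs = {f \<in> M. v \<in> set f} \<and>
     (\<forall>i < length fs. \<exists>u. {v, u} \<in> face_edges (fs ! i) \<inter>
                                    face_edges (fs ! ((i + 1) mod length fs)))"

definition polyhedral_map :: "'a list set \<Rightarrow> bool" where
  "polyhedral_map M \<longleftrightarrow>
     finite M \<and> M \<noteq> {} \<and>
     (\<forall>f \<in> M. distinct f \<and> length f \<ge> 3) \<and>
     (\<forall>f \<in> M. \<forall>g \<in> M. f \<noteq> g \<longrightarrow>
        set f \<inter> set g = {} \<or> card (set f \<inter> set g) = 1 \<or>
        set f \<inter> set g \<in> face_edges f \<inter> face_edges g) \<and>
     (\<forall>e \<in> map_edges M. card {f \<in> M. e \<in> face_edges f} = 2) \<and>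
     (\<forall>v \<in> map_verts M. \<exists>fs. face_cycle M v fs) \<and>
     (\<forall>u \<in> map_verts M. \<forall>w \<in> map_verts M.
        (\<lambda>x y. {x, y} \<in> map_edges M)\<^sup>*\<^sup>* u w)"

definition euler_char :: "'a list set \<Rightarrow> int" where
  "euler_char M = int (card (map_verts M)) - int (card (map_edges M)) + int (card M)"

definition semi_equivelar :: "nat list \<Rightarrow> 'a list set \<Rightarrow> bool" where
  "semi_equivelar tp M \<longleftrightarrow> polyhedral_map M \<and>
     (\<forall>v \<in> map_verts M. \<exists>fs. face_cycle M v fs \<and>
        (\<exists>n. rotate n (map length fs) = tp \<or> rotate n (rev (map length fs)) = tp))"

end

theory Submission
  imports Defs "HOL-Combinatorics.Cycles"
begin

text \<open>Counting incidences turns the Euler characteristic into the number of vertices and of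
  \<open>n\<close>-gons for each \<open>n\<close>. For four of the types this contradicts at once that two faces share at
  most an edge: for instance, a 12-gon in type (4,8,12) is covered by 3 octagons, each meeting it
  in at most 2 vertices.

  In type (3,3,3,3,8) there are 24 vertices, partitioned by 3 octagons. Mapping an octagon edge to
  the apex of the triangle standing on it is a bijection onto the vertices. Hence exactly one of the
  two inner triangles at a vertex \<open>v\<close> stands on an octagon edge, and this chirality singles out one
  octagon neighbour \<open>\<nu> v\<close> of \<open>v\<close> and the apex \<open>\<epsilon> v\<close> of the triangle on the edge from \<open>v\<close> to
  \<open>\<nu> v\<close>. Then \<open>\<nu>\<close> is a product of three 8-cycles, \<open>\<epsilon>\<close> is a product of 12 disjoint transpositions,
  and \<open>\<nu> \<circ> \<epsilon>\<close> rotates the triangles without octagon edges and so has order 3. The signs of these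
  permutations, -1, 1 and 1, are incompatible.\<close>

section \<open>Faces and incidence counts\<close>

lemma face_edges_neighbours:
  assumes "distinct f" "3 \<le> length f" "v \<in> set f"
  obtains p q where "p \<noteq> q" "p \<in> set f" "q \<in> set f" "p \<noteq> v" "q \<noteq> v"
    "\<And>u. {v, u} \<in> face_edges f \<longleftrightarrow> u = p \<or> u = q"
proof -
  let ?n = "length f"
  obtain i where i: "i < ?n" "f ! i = v" using assms(3) by (auto simp: in_set_conv_nth)
  define s where "s = (i + 1) mod ?n"
  \<comment> \<open>The cyclic predecessor of \<open>i\<close>, defined by cases because subtraction
    on naturals truncates at 0.\<close>
  define r where "r = (if i = 0 then ?n - 1 else i - 1)"
  have s: "s < ?n" "s \<noteq> i" "r < ?n" "r \<noteq> i" "s \<noteq> r" "(r + 1) mod ?n = i"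
    using i(1) assms(2) by (auto simp: s_def r_def mod_Suc)
  have uniq: "j = r" if "j < ?n" "(j + 1) mod ?n = i" for j
    using that i(1) assms(2) by (auto simp: r_def mod_Suc split: if_splits)
  have nth: "f ! j = f ! k \<longleftrightarrow> j = k" if "j < ?n" "k < ?n" for j k
    using that assms(1) by (simp add: nth_eq_iff_index_eq)
  have "{v, u} \<in> face_edges f \<longleftrightarrow> u = f ! s \<or> u = f ! r" for u
  proof
    assume "{v, u} \<in> face_edges f"
    then obtain j where j: "j < ?n" "{v, u} = {f ! j, f ! ((j + 1) mod ?n)}"
      unfolding face_edges_def by blast
    have "(j + 1) mod ?n < ?n" using i(1) by (intro mod_less_divisor) linarith
    then show "u = f ! s \<or> u = f ! r"
      using j i nth uniq[OF j(1)] unfolding doubleton_eq_iff s_def by metis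
  next
    assume "u = f ! s \<or> u = f ! r"
    then show "{v, u} \<in> face_edges f"
      unfolding face_edges_def mem_Collect_eq
      using i s s_def by (metis insert_commute)
  qed
  with that[of "f ! s" "f ! r"] s i nth show thesis by (metis nth_mem)
qed

lemma face_edges_card:
  assumes "distinct f" "3 \<le> length f" "e \<in> face_edges f"
  shows "e \<subseteq> set f" "card e = 2"
proof -
  obtain i where i: "i < length f" "e = {f ! i, f ! ((i + 1) mod length f)}"
    using assms(3) unfolding face_edges_def by blast
  have m: "(i + 1) mod length f < length f" "(i + 1) mod length f \<noteq> i"
    using i(1) assms(2) by (auto simp: mod_Suc)
  then show "e \<subseteq> set f" using i by simp
  have "f ! i \<noteq> f ! ((i + 1) mod length f)" using m i assms(1) by (simp add: nth_eq_iff_index_eq)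
  then show "card e = 2" using i by simp
qed

lemma card_face_edges:
  assumes "distinct f" "3 \<le> length f"
  shows "card (face_edges f) = length f"
proof -
  let ?n = "length f"
  have "inj_on (\<lambda>i. {f ! i, f ! ((i + 1) mod ?n)}) {..<?n}"
  proof (rule inj_onI)
    fix i j assume ij: "i \<in> {..<?n}" "j \<in> {..<?n}"
      "{f ! i, f ! ((i + 1) mod ?n)} = {f ! j, f ! ((j + 1) mod ?n)}"
    have "(i + 1) mod ?n < ?n" "(j + 1) mod ?n < ?n"
      using assms(2) by (intro mod_less_divisor; linarith)+
    \<comment> \<open>Distinct indices with the same edge would each be the cyclic successor of the
      other, which forces length 2.\<close>
    then have "i = j \<or> i = (j + 1) mod ?n \<and> (i + 1) mod ?n = j"
      using ij assms(1) unfolding doubleton_eq_iff by (auto simp: nth_eq_iff_index_eq)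
    then show "i = j" using ij assms(2) by (auto simp: mod_Suc split: if_splits)
  qed
  moreover have "face_edges f = (\<lambda>i. {f ! i, f ! ((i + 1) mod ?n)}) ` {..<?n}"
    unfolding face_edges_def by auto
  ultimately show ?thesis by (simp add: card_image)
qed

section \<open>Rotating and reversing cyclic lists of faces\<close>

lemma cyclic_successively_rotate:
  assumes "\<forall>i<length xs. P (xs ! i) (xs ! ((i + 1) mod length xs))"
  shows "\<forall>i<length (rotate k xs). P (rotate k xs ! i) (rotate k xs ! ((i + 1) mod length (rotate k xs)))"
proof (intro allI impI)
  fix i assume i: "i < length (rotate k xs)"
  then have n: "0 < length xs" by auto
  have "(i + 1) mod length xs < length xs" using n by simp
  then have "rotate k xs ! i = xs ! ((k + i) mod length xs)"
    "rotate k xs ! ((i + 1) mod length xs) = xs ! (((k + i) mod length xs + 1) mod length xs)"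
    using i by (simp_all add: nth_rotate mod_simps)
  with assms n show "P (rotate k xs ! i) (rotate k xs ! ((i + 1) mod length (rotate k xs)))" by simp
qed

lemma cyclic_successively_rev:
  assumes "\<forall>i<length xs. P (xs ! i) (xs ! ((i + 1) mod length xs))" "\<And>x y. P x y \<Longrightarrow> P y x"
  shows "\<forall>i<length (rev xs). P (rev xs ! i) (rev xs ! ((i + 1) mod length (rev xs)))"
proof (intro allI impI)
  fix i assume i: "i < length (rev xs)"
  let ?n = "length xs"
  show "P (rev xs ! i) (rev xs ! ((i + 1) mod length (rev xs)))"
  proof (cases "i + 1 = ?n")
    \<comment> \<open>The wrap-around pair of \<open>rev xs\<close> is the wrap-around pair of
      \<open>xs\<close> read backwards; all other pairs are interior.\<close>
    case True
    have "P (xs ! (?n - 1)) (xs ! ((?n - 1 + 1) mod ?n))" using assms(1) True by auto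
    moreover have "rev xs ! i = xs ! 0" using True by (simp add: rev_nth)
    moreover have "rev xs ! 0 = xs ! (?n - 1)" "(i + 1) mod ?n = 0"
      using True rev_nth[of 0 xs] by (auto simp flip: length_greater_0_conv)
    moreover have "?n - 1 + 1 = ?n" using True by simp
    ultimately show ?thesis using assms(2) by simp
  next
    case False
    let ?j = "?n - Suc (Suc i)"
    have j: "?j < ?n" "(?j + 1) mod ?n = ?n - Suc i" "(i + 1) mod ?n = Suc i" using False i by auto
    have "P (xs ! ?j) (xs ! ((?j + 1) mod ?n))" using assms(1) j by auto
    then show ?thesis using j i False assms(2) by (simp add: rev_nth)
  qed
qed

lemma face_cycle_rotate: "face_cycle M v fs \<Longrightarrow> face_cycle M v (rotate k fs)"
  unfolding face_cycle_def
  using cyclic_successively_rotate[of fs "\<lambda>f g. \<exists>u. {v, u} \<in> face_edges f \<inter> face_edges g" k]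
  by simp

lemma face_cycle_rev: "face_cycle M v fs \<Longrightarrow> face_cycle M v (rev fs)"
  unfolding face_cycle_def
  using cyclic_successively_rev[of fs "\<lambda>f g. \<exists>u. {v, u} \<in> face_edges f \<inter> face_edges g"]
  by (simp add: Int_commute)

section \<open>Local structure and double counting in a semi-equivelar map\<close>

locale semi_equivelar_map =
  fixes tp :: "nat list" and M :: "'a list set"
  assumes semi_equivelar: "semi_equivelar tp M"
begin

abbreviation "V \<equiv> map_verts M"

definition "polygons n = {f \<in> M. length f = n}"

lemma polyhedral: "polyhedral_map M"
  using semi_equivelar by (simp add: semi_equivelar_def)

lemma finite_M: "finite M" and M_nonempty: "M \<noteq> {}"
  and face: "f \<in> M \<Longrightarrow> distinct f" "f \<in> M \<Longrightarrow> 3 \<le> length f"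
  and edge_card: "e \<in> map_edges M \<Longrightarrow> card {f \<in> M. e \<in> face_edges f} = 2"
  using polyhedral unfolding polyhedral_map_def by auto

lemma face_Int:
  assumes "f \<in> M" "g \<in> M" "f \<noteq> g"
  shows "card (set f \<inter> set g) \<le> 2"
    and "2 \<le> card (set f \<inter> set g) \<Longrightarrow> set f \<inter> set g \<in> face_edges f \<inter> face_edges g"
proof -
  have *: "set f \<inter> set g = {} \<or> card (set f \<inter> set g) = 1 \<or>
        set f \<inter> set g \<in> face_edges f \<inter> face_edges g"
    using polyhedral assms unfolding polyhedral_map_def by blast
  then show "card (set f \<inter> set g) \<le> 2"
    using face_edges_card(2)[of f "set f \<inter> set g"] face[OF assms(1)] by fastforce
  show "set f \<inter> set g \<in> face_edges f \<inter> face_edges g" if "2 \<le> card (set f \<inter> set g)"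
    using * that by auto
qed

lemma finite_verts: "finite V" and finite_edges: "finite (map_edges M)"
  unfolding map_verts_def map_edges_def face_edges_def using finite_M by auto

lemma face_in_verts: "f \<in> M \<Longrightarrow> set f \<subseteq> V"
  unfolding map_verts_def by auto

lemma finite_polygons: "finite (polygons n)"
  using finite_M by (simp add: polygons_def)

lemma edge_two_faces:
  assumes "f \<in> M" "g \<in> M" "h \<in> M" "e \<in> face_edges f" "e \<in> face_edges g" "e \<in> face_edges h" "f \<noteq> g"
  shows "h = f \<or> h = g"
proof (rule ccontr)
  assume "\<not> ?thesis"
  then have "card {f, g, h} = 3" using assms(7) by auto
  moreover have "card {f, g, h} \<le> card {f \<in> M. e \<in> face_edges f}"
    using assms finite_M by (intro card_mono) auto
  moreover have "e \<in> map_edges M" using assms unfolding map_edges_def by auto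
  ultimately show False using edge_card by auto
qed

text \<open>Face cycles may be rotated and reversed, so the freedom in the type can be moved into
  the choice of \<open>fs\<close>. Later arguments then read off face sizes position by
  position.\<close>

lemma vertex_cycle:
  assumes "v \<in> V"
  obtains fs where "face_cycle M v fs" "map length fs = tp"
proof -
  obtain fs n where fs: "face_cycle M v fs"
    and n: "rotate n (map length fs) = tp \<or> rotate n (rev (map length fs)) = tp"
    using semi_equivelar assms unfolding semi_equivelar_def by blast
  from n show thesis
  proof
    assume "rotate n (map length fs) = tp"
    then show thesis using that[of "rotate n fs"] face_cycle_rotate[OF fs] by (simp add: rotate_map)
  next
    assume "rotate n (rev (map length fs)) = tp"
    then show thesis using that[of "rotate n (rev fs)"] face_cycle_rotate[OF face_cycle_rev[OF fs]]
      by (simp add: rotate_map rev_map)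
  qed
qed

text \<open>A face at \<open>v\<close> has just two edges at \<open>v\<close>. The cycle already
  provides two, shared with the predecessor and the successor, and these differ because an edge lies
  in only two faces. So any face that shares an edge at \<open>v\<close> with \<open>f\<close> is
  one of these two.\<close>

lemma adjacent_faces:
  assumes fs: "face_cycle M v fs" and "f \<in> M" "g \<in> M" "f \<noteq> g"
    and "{v, u} \<in> face_edges f" "{v, u} \<in> face_edges g"
  shows "\<exists>i<length fs. {f, g} = {fs ! i, fs ! ((i + 1) mod length fs)}"
proof -
  let ?n = "length fs"
  have n: "3 \<le> ?n" "distinct fs" and fsM: "set fs = {f \<in> M. v \<in> set f}"
    and "\<forall>i. \<exists>u. i < ?n \<longrightarrow> {v, u} \<in> face_edges (fs ! i) \<inter> face_edges (fs ! ((i + 1) mod ?n))"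
    using fs unfolding face_cycle_def by auto
  then obtain w where w: "\<And>i. i < ?n \<Longrightarrow> {v, w i} \<in> face_edges (fs ! i)"
    "\<And>i. i < ?n \<Longrightarrow> {v, w i} \<in> face_edges (fs ! ((i + 1) mod ?n))" by (metis IntE)
  have "v \<in> set f" using face_edges_card(1)[of f "{v, u}"] face assms by auto
  then have "f \<in> set fs" using fsM assms by auto
  then obtain i where i: "i < ?n" "f = fs ! i" by (auto simp: in_set_conv_nth)
  define j where "j = (if i = 0 then ?n - 1 else i - 1)"
  define s where "s = (i + 1) mod ?n"
  have j: "j < ?n" "(j + 1) mod ?n = i" "j \<noteq> i" "s < ?n" "s \<noteq> i" "s \<noteq> j"
    using i(1) n by (auto simp: j_def s_def mod_Suc)
  have in_M: "fs ! k \<in> M" if "k < ?n" for k using that fsM nth_mem by blast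
  have neq: "fs ! k = fs ! l \<longleftrightarrow> k = l" if "k < ?n" "l < ?n" for k l
    using that n by (simp add: nth_eq_iff_index_eq)
  have "w i \<noteq> w j"
  proof
    assume "w i = w j"
    then have "fs ! j = fs ! i \<or> fs ! j = fs ! s"
      using edge_two_faces[of "fs ! i" "fs ! s" "fs ! j" "{v, w i}"] w[OF i(1)] w[OF j(1)] j i in_M neq
      unfolding s_def[symmetric] by auto
    then show False using neq j i by metis
  qed
  moreover have "{v, w i} \<in> face_edges f" "{v, w j} \<in> face_edges f"
    using w[OF i(1)] w(2)[OF j(1)] i j by auto
  moreover obtain p q where "\<And>u. {v, u} \<in> face_edges f \<longleftrightarrow> u = p \<or> u = q"
    using face_edges_neighbours[of f v] face assms \<open>v \<in> set f\<close> by metis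
  ultimately have "u = w i \<or> u = w j" using assms by metis
  then show ?thesis
  proof
    assume "u = w i"
    then have "g = f \<or> g = fs ! s"
      using edge_two_faces[of f "fs ! s" g "{v, u}"] w[OF i(1)] assms i j in_M neq
      unfolding s_def[symmetric] by auto
    then show ?thesis using assms i unfolding s_def by auto
  next
    assume "u = w j"
    then have "g = f \<or> g = fs ! j"
      using edge_two_faces[of f "fs ! j" g "{v, u}"] w[OF j(1)] assms i j in_M neq by auto
    then have "{f, g} = {fs ! j, fs ! ((j + 1) mod ?n)}" using assms i j by auto
    then show ?thesis using j by blast
  qed
qed

text \<open>Two faces with two common vertices share an edge, hence are consecutive around an end of
  it. The list \<open>zip tp (rotate1 tp)\<close> holds the cyclically consecutive pairs of sizes,
  so sizes not adjacent in the type allow at most one common vertex.\<close>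

lemma adjacent_lengths:
  assumes "f \<in> polygons n" "g \<in> polygons m" "f \<noteq> g" "2 \<le> card (set f \<inter> set g)"
  shows "(n, m) \<in> set (zip tp (rotate1 tp)) \<or> (m, n) \<in> set (zip tp (rotate1 tp))"
proof -
  have fg: "f \<in> M" "g \<in> M" "length f = n" "length g = m" using assms by (auto simp: polygons_def)
  have e: "set f \<inter> set g \<in> face_edges f \<inter> face_edges g" using face_Int(2)[OF fg(1,2)] assms by auto
  then have "card (set f \<inter> set g) = 2" using face_edges_card(2)[of f] face fg by blast
  then obtain v u where vu: "set f \<inter> set g = {v, u}" by (auto simp: card_2_iff)
  then have "v \<in> V" using face_in_verts[OF fg(1)] by auto
  then obtain fs where fs: "face_cycle M v fs" "map length fs = tp" by (rule vertex_cycle)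
  obtain i where i: "i < length fs" "{f, g} = {fs ! i, fs ! ((i + 1) mod length fs)}"
    using adjacent_faces[OF fs(1) fg(1,2) assms(3), of u] e vu by auto
  have len: "length tp = length fs" "\<And>k. k < length fs \<Longrightarrow> tp ! k = length (fs ! k)" using fs(2) by auto
  let ?s = "(i + 1) mod length fs"
  have "?s < length fs" using i(1) by (intro mod_less_divisor) linarith
  then have "(length (fs ! i), length (fs ! ?s)) = zip tp (rotate1 tp) ! i" "i < length (zip tp (rotate1 tp))"
    using i(1) len by (simp_all add: nth_rotate1)
  then have "(length (fs ! i), length (fs ! ?s)) \<in> set (zip tp (rotate1 tp))" using nth_mem by metis
  then show ?thesis using i(2) fg unfolding doubleton_eq_iff by auto
qed

lemma card_polygons_at_vertex:
  assumes "v \<in> V"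
  shows "card {f \<in> polygons n. v \<in> set f} = count_list tp n"
proof -
  obtain fs where fs: "face_cycle M v fs" "map length fs = tp" using vertex_cycle[OF assms] .
  have "{f \<in> polygons n. v \<in> set f} = set (filter (\<lambda>f. length f = n) fs)"
    using fs unfolding face_cycle_def polygons_def by auto
  also have "card \<dots> = length (filter (\<lambda>f. length f = n) fs)"
    using fs unfolding face_cycle_def by (intro distinct_card distinct_filter) blast
  also have "\<dots> = count_list (map length fs) n" by (induction fs) auto
  finally show ?thesis using fs by simp
qed

text \<open>Double counting of the incident pairs of a vertex and an \<open>n\<close>-gon.\<close>

lemma card_polygons: "n * card (polygons n) = card V * count_list tp n"
proof -
  have "(\<Sum>f\<in>polygons n. card {v \<in> V. v \<in> set f}) = (\<Sum>v\<in>V. count_list tp n)"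
    by (rule sum_multicount_gen) (use finite_polygons finite_verts card_polygons_at_vertex in auto)
  moreover have "card {v \<in> V. v \<in> set f} = n" if "f \<in> polygons n" for f
  proof -
    have "{v \<in> V. v \<in> set f} = set f" using that face_in_verts by (auto simp: polygons_def)
    then show ?thesis using that face by (auto simp: polygons_def distinct_card)
  qed
  ultimately show ?thesis by (simp add: mult.commute)
qed

lemma length_in_type:
  assumes "f \<in> M"
  shows "length f \<in> set tp"
proof -
  have "f \<noteq> []" using face[OF assms] by auto
  then have v: "hd f \<in> set f" by simp
  then have "hd f \<in> V" using face_in_verts[OF assms] by auto
  then obtain fs where fs: "face_cycle M (hd f) fs" "map length fs = tp" by (rule vertex_cycle)
  then have "f \<in> set fs" using v assms unfolding face_cycle_def by auto
  then show ?thesis using fs(2) by auto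
qed

lemma card_faces: "card M = (\<Sum>n\<leftarrow>remdups tp. card (polygons n))"
proof -
  have "card M = (\<Sum>n\<in>set tp. card (polygons n))"
    using sum.group[of M "set tp" length "\<lambda>_. 1::nat"] finite_M length_in_type
    by (simp add: polygons_def image_subset_iff)
  then show ?thesis by (simp add: sum_list_distinct_conv_sum_set)
qed

text \<open>Double counting of the incident pairs of an edge and a face. The sum of the face lengths
  is then grouped by size and evaluated with \<open>card_polygons\<close>.\<close>

lemma card_edges: "2 * card (map_edges M) = card V * length tp"
proof -
  have "(\<Sum>f\<in>M. card {e \<in> map_edges M. e \<in> face_edges f}) = (\<Sum>e\<in>map_edges M. 2)"
    by (rule sum_multicount_gen) (use finite_M finite_edges edge_card in auto)
  moreover have "card {e \<in> map_edges M. e \<in> face_edges f} = length f" if "f \<in> M" for f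
  proof -
    have "{e \<in> map_edges M. e \<in> face_edges f} = face_edges f" using that by (auto simp: map_edges_def)
    then show ?thesis using that face card_face_edges by auto
  qed
  ultimately have "2 * card (map_edges M) = (\<Sum>f\<in>M. length f)" by simp
  also have "\<dots> = (\<Sum>n\<in>set tp. \<Sum>f\<in>polygons n. length f)"
    using sum.group[of M "set tp" length length] finite_M length_in_type
    by (simp add: polygons_def image_subset_iff)
  also have "\<dots> = (\<Sum>n\<in>set tp. n * card (polygons n))"
    by (intro sum.cong) (auto simp: polygons_def)
  also have "\<dots> = card V * (\<Sum>n\<in>set tp. count_list tp n)"
    by (simp add: card_polygons sum_distrib_left)
  finally show ?thesis by (simp add: sum_count_set)
qed

lemma verts_nonempty: "0 < card V"
proof -
  obtain f where f: "f \<in> M" using M_nonempty by blast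
  then have "set f \<noteq> {}" using face by fastforce
  then show ?thesis using finite_verts face_in_verts[OF f] by (auto simp: card_gt_0_iff)
qed

text \<open>The union bound behind the counting contradictions: few faces, each meeting
  \<open>f\<close> in few vertices, cannot cover \<open>f\<close>.\<close>

lemma face_vertices_le:
  assumes "f \<in> M" "G \<subseteq> M" "set f \<subseteq> (\<Union>g\<in>G. set g)" "\<And>g. g \<in> G \<Longrightarrow> card (set f \<inter> set g) \<le> k"
  shows "length f \<le> card G * k"
proof -
  have "finite G" using assms finite_M finite_subset by blast
  have "length f = card (set f)" using face assms by (simp add: distinct_card)
  also have "set f = (\<Union>g\<in>G. set f \<inter> set g)" using assms by auto
  also have "card \<dots> \<le> (\<Sum>g\<in>G. card (set f \<inter> set g))" using \<open>finite G\<close> by (rule card_UN_le)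
  also have "\<dots> \<le> card G * k" using sum_bounded_above[of G "\<lambda>g. card (set f \<inter> set g)" k] assms by simp
  finally show ?thesis .
qed

lemma polygon_at_vertex:
  assumes "v \<in> V" "n \<in> set tp"
  obtains f where "f \<in> polygons n" "v \<in> set f"
proof -
  have "card {f \<in> polygons n. v \<in> set f} \<noteq> 0"
    using card_polygons_at_vertex[OF assms(1)] assms(2) by (simp add: count_list_0_iff)
  then show thesis using that by (metis (mono_tags, lifting) card.empty empty_Collect_eq mem_Collect_eq)
qed

lemma polygons_nonempty:
  assumes "n \<in> set tp"
  obtains f where "f \<in> polygons n"
  using verts_nonempty polygon_at_vertex[OF _ assms] by (metis card.empty equals0I less_irrefl)

end

section \<open>Types excluded by counting\<close>

lemma (in semi_equivelar_map) face_covered_by_polygons: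
  assumes "f \<in> M" "n \<in> set tp"
  shows "set f \<subseteq> (\<Union>g\<in>polygons n. set g)"
  using face_in_verts[OF assms(1)] polygon_at_vertex[OF _ assms(2)] by blast

lemma no_semi_equivelar_4_8_12:
  assumes "euler_char M = -1"
  shows "\<not> semi_equivelar [4,8,12] M"
proof
  assume "semi_equivelar [4,8,12] M"
  then interpret semi_equivelar_map "[4,8,12]" M by unfold_locales
  have "card (polygons 8) = 3"
    using card_polygons[of 4] card_polygons[of 8] card_polygons[of 12] card_faces card_edges
      assms[unfolded euler_char_def] by simp
  moreover obtain f where f: "f \<in> polygons 12" by (rule polygons_nonempty[of 12]) auto
  have "length f \<le> card (polygons 8) * 2"
  proof (rule face_vertices_le)
    show "f \<in> M" "polygons 8 \<subseteq> M" using f by (auto simp: polygons_def)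
    then show "set f \<subseteq> (\<Union>g\<in>polygons 8. set g)" by (intro face_covered_by_polygons) auto
    show "card (set f \<inter> set g) \<le> 2" if "g \<in> polygons 8" for g
      using that f by (intro face_Int) (auto simp: polygons_def)
  qed
  ultimately show False using f by (simp add: polygons_def)
qed

text \<open>There are 4 hexagons, two at each vertex, so the other 3 cover a given one. Since 6 is
  not next to 6 in the type, each of them covers at most one of its 6 vertices.\<close>

lemma no_semi_equivelar_3_6_4_6:
  assumes "euler_char M = -1"
  shows "\<not> semi_equivelar [3,6,4,6] M"
proof
  assume "semi_equivelar [3,6,4,6] M"
  then interpret semi_equivelar_map "[3,6,4,6]" M by unfold_locales
  have c: "card (polygons 6) = 4"
    using card_polygons[of 3] card_polygons[of 4] card_polygons[of 6] card_faces card_edges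
      assms[unfolded euler_char_def] by simp
  obtain f where f: "f \<in> polygons 6" by (rule polygons_nonempty[of 6]) auto
  have "length f \<le> card (polygons 6 - {f}) * 1"
  proof (rule face_vertices_le)
    show "f \<in> M" "polygons 6 - {f} \<subseteq> M" using f by (auto simp: polygons_def)
    show "set f \<subseteq> (\<Union>g\<in>polygons 6 - {f}. set g)"
    proof
      fix v assume v: "v \<in> set f"
      then have "card {g \<in> polygons 6. v \<in> set g} = 2"
        using card_polygons_at_vertex[of v 6] face_in_verts[OF \<open>f \<in> M\<close>] by auto
      moreover have "card {g \<in> polygons 6. v \<in> set g} \<le> card {f}"
        if "v \<notin> (\<Union>g\<in>polygons 6 - {f}. set g)"
        using that by (intro card_mono) auto
      ultimately show "v \<in> (\<Union>g\<in>polygons 6 - {f}. set g)" by fastforce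
    qed
    show "card (set f \<inter> set g) \<le> 1" if "g \<in> polygons 6 - {f}" for g
    proof (rule ccontr)
      assume "\<not> ?thesis"
      then show False using adjacent_lengths[of f 6 g 6] that f by auto
    qed
  qed
  then show False using f c finite_polygons by (simp add: polygons_def)
qed

text \<open>The 2 hexagons cover every quadrangle, but 4 and 6 are not adjacent in the type, so each
  hexagon contains at most one of the 4 corners.\<close>

lemma no_semi_equivelar_3_3_4_3_6:
  assumes "euler_char M = -1"
  shows "\<not> semi_equivelar [3,3,4,3,6] M"
proof
  assume "semi_equivelar [3,3,4,3,6] M"
  then interpret semi_equivelar_map "[3,3,4,3,6]" M by unfold_locales
  have c: "card (polygons 6) = 2"
    using card_polygons[of 3] card_polygons[of 4] card_polygons[of 6] card_faces card_edges
      assms[unfolded euler_char_def] by simp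
  obtain f where f: "f \<in> polygons 4" by (rule polygons_nonempty[of 4]) auto
  have "length f \<le> card (polygons 6) * 1"
  proof (rule face_vertices_le)
    show "f \<in> M" "polygons 6 \<subseteq> M" using f by (auto simp: polygons_def)
    then show "set f \<subseteq> (\<Union>g\<in>polygons 6. set g)" by (intro face_covered_by_polygons) auto
    show "card (set f \<inter> set g) \<le> 1" if "g \<in> polygons 6" for g
    proof (rule ccontr)
      assume "\<not> ?thesis"
      moreover have "f \<noteq> g" using f that by (auto simp: polygons_def)
      ultimately show False using adjacent_lengths[of f 4 g 6] that f by auto
    qed
  qed
  then show False using f c by (simp add: polygons_def)
qed

text \<open>The 2 hexagons cover each of the 9 quadrangles and contain at most two of its corners
  each, hence exactly two. So every quadrangle stands on its own edge of the hexagon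
  \<open>h\<close>, which has only 6 edges.\<close>

lemma no_semi_equivelar_4_4_4_6:
  assumes "euler_char M = -1"
  shows "\<not> semi_equivelar [4,4,4,6] M"
proof
  assume "semi_equivelar [4,4,4,6] M"
  then interpret semi_equivelar_map "[4,4,4,6]" M by unfold_locales
  have c: "card (polygons 6) = 2" "card (polygons 4) = 9"
    using card_polygons[of 4] card_polygons[of 6] card_faces card_edges
      assms[unfolded euler_char_def] by simp_all
  obtain h k where hk: "polygons 6 = {h, k}" "h \<noteq> k" using c by (auto simp: card_2_iff)
  then have h: "h \<in> M" "length h = 6" "k \<in> M" "length k = 6" by (auto simp: polygons_def)
  have shared: "set q \<inter> set h \<in> face_edges q \<inter> face_edges h" if q: "q \<in> polygons 4" for q
  proof -
    have qM: "q \<in> M" "length q = 4" "q \<noteq> h" "q \<noteq> k" using q h by (auto simp: polygons_def)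
    have "set q = (set q \<inter> set h) \<union> (set q \<inter> set k)"
      using face_covered_by_polygons[of q 6] qM hk by auto
    then have "card (set q) \<le> card (set q \<inter> set h) + card (set q \<inter> set k)"
      using card_Un_le by metis
    moreover have "card (set q) = 4" using face qM by (simp add: distinct_card)
    moreover have "card (set q \<inter> set k) \<le> 2" using face_Int(1) qM h by auto
    ultimately show ?thesis using face_Int(2)[of q h] qM h by auto
  qed
  have "inj_on (\<lambda>q. set q \<inter> set h) (polygons 4)"
  proof (rule inj_onI)
    fix q r assume qr: "q \<in> polygons 4" "r \<in> polygons 4" "set q \<inter> set h = set r \<inter> set h"
    have M: "q \<noteq> h" "r \<noteq> h" "q \<in> M" "r \<in> M" using qr(1,2) h by (auto simp: polygons_def)
    define e where "e = set q \<inter> set h"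
    have "e \<in> face_edges q" "e \<in> face_edges r" "e \<in> face_edges h"
      using shared[OF qr(1)] shared[OF qr(2)] qr(3) unfolding e_def by auto
    then show "q = r" using edge_two_faces[of q h r e] M h by blast
  qed
  moreover have "(\<lambda>q. set q \<inter> set h) ` polygons 4 \<subseteq> face_edges h" using shared by auto
  moreover have "finite (face_edges h)" unfolding face_edges_def by auto
  ultimately have "card (polygons 4) \<le> card (face_edges h)" by (rule card_inj_on_le)
  then show False using c h card_face_edges[of h] face by simp
qed

section \<open>Signs of permutations and cycles along a face\<close>

lemma sign_cycle_of_list:
  assumes "distinct cs" "cs \<noteq> []"
  shows "sign (cycle_of_list cs) = (-1) ^ (length cs - 1)"
  using assms
proof (induction cs rule: cycle_of_list.induct)
  case (1 i j cs)
  then show ?case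
    by (simp add: sign_compose permutation_of_cycle permutation_swap_id sign_swap_id del: comp_apply o_apply)
qed auto

text \<open>A cycle of even length is odd, and signs multiply over disjoint cycles, so each block
  contributes a factor -1.\<close>

lemma sign_on_even_cycles:
  assumes "finite C" "pairwise disjnt C"
    and "\<And>B. B \<in> C \<Longrightarrow> \<exists>cs. set cs = B \<and> distinct cs \<and> cs \<noteq> [] \<and> even (length cs) \<and>
      (\<forall>x\<in>B. p x = cycle_of_list cs x)"
  shows "bij_betw p (\<Union>C) (\<Union>C)" and "sign_on (\<Union>C) p = (-1) ^ card C"
proof -
  \<comment> \<open>The induction runs on the extension of \<open>p\<close> by the identity, which
    is a permutation of the whole type and so has a \<open>sign\<close>.\<close>
  have *: "restrict_id p (\<Union>C) permutes \<Union>C \<and> sign (restrict_id p (\<Union>C)) = (-1) ^ card C"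
    using assms
  proof (induction C rule: finite_induct)
    case empty
    have "restrict_id p (\<Union>{}) = id" by auto
    then show ?case by (simp only: permutes_id sign_id card.empty power_0)
  next
    case (insert B C)
    obtain cs where cs: "set cs = B" "distinct cs" "cs \<noteq> []" "even (length cs)"
      "\<And>x. x \<in> B \<Longrightarrow> p x = cycle_of_list cs x"
      using insert.prems(2)[of B] by auto
    have disj: "B \<inter> \<Union>C = {}"
      using insert.prems(1) insert.hyps(2) unfolding pairwise_def disjnt_def by auto
    have finC: "finite (\<Union>C)"
      using insert.prems(2) insert.hyps(1) by (metis List.finite_set finite_Union insertCI)
    let ?r = "restrict_id p (\<Union>C)"
    have IH: "?r permutes \<Union>C" "sign ?r = (-1) ^ card C"
      using insert.IH insert.prems by (auto simp: pairwise_insert)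
    have perm_cs: "cycle_of_list cs permutes B" using cycle_permutes[of cs] cs by simp
    have eq: "restrict_id p (\<Union>(insert B C)) = cycle_of_list cs \<circ> ?r"
    proof
      fix x
      consider "x \<in> B" | "x \<in> \<Union>C" | "x \<notin> B" "x \<notin> \<Union>C" by blast
      then show "restrict_id p (\<Union>(insert B C)) x = (cycle_of_list cs \<circ> ?r) x"
      proof cases
        case 1
        then have "x \<notin> \<Union>C" using disj by auto
        with 1 show ?thesis using cs(5) by (simp add: restrict_id_def)
      next
        case 2
        then have "?r x \<in> \<Union>C" by (simp only: permutes_in_image[OF IH(1)])
        then have "?r x \<notin> set cs" using disj cs by auto
        then have "cycle_of_list cs (?r x) = ?r x" by (rule id_outside_supp)
        with 2 show ?thesis by (simp add: restrict_id_def)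
      next
        case 3
        then show ?thesis using cs id_outside_supp[of x cs] by (simp add: restrict_id_def)
      qed
    qed
    have "cycle_of_list cs permutes \<Union>(insert B C)" "?r permutes \<Union>(insert B C)"
      using perm_cs IH(1) by (auto intro: permutes_subset)
    then have "restrict_id p (\<Union>(insert B C)) permutes \<Union>(insert B C)"
      unfolding eq by (intro permutes_compose)
    moreover have "sign (cycle_of_list cs \<circ> ?r) = sign (cycle_of_list cs) * sign ?r"
      using IH(1) finC permutation_permutes by (intro sign_compose permutation_of_cycle) blast
    moreover have "sign (cycle_of_list cs) = -1"
      using cs sign_cycle_of_list[of cs] by (simp add: uminus_power_if)
    moreover have "sign (cycle_of_list cs \<circ> ?r) = (-1) ^ card (insert B C)"
      using calculation(2,3) IH(2) insert.hyps by simp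
    ultimately show ?case by (simp only: eq simp_thms)
  qed
  then show "sign_on (\<Union>C) p = (-1) ^ card C" by (simp add: sign_on_def)
  have "bij_betw (restrict_id p (\<Union>C)) (\<Union>C) (\<Union>C)" using * permutes_imp_bij by blast
  then show "bij_betw p (\<Union>C) (\<Union>C)"
    by (rule bij_betw_cong[THEN iffD1, rotated]) (simp add: restrict_id_def)
qed

lemma cycle_of_list_nth:
  assumes "distinct cs" "i < length cs"
  shows "cycle_of_list cs (cs ! i) = cs ! (Suc i mod length cs)"
proof -
  have "map (cycle_of_list cs) cs = rotate1 cs" using cyclic_rotation[OF assms(1), of 1] by simp
  then have "map (cycle_of_list cs) cs ! i = rotate1 cs ! i" by simp
  then show ?thesis using assms(2) by (simp add: nth_rotate1)
qed

text \<open>The orbits \<open>{v, f v}\<close> partition \<open>S\<close> into pairs, and on each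
  pair \<open>f\<close> is the 2-cycle \<open>[v, f v]\<close>.\<close>

lemma sign_on_fixpoint_free_involution:
  assumes "finite S" "\<And>v. v \<in> S \<Longrightarrow> f v \<in> S" "\<And>v. v \<in> S \<Longrightarrow> f (f v) = v" "\<And>v. v \<in> S \<Longrightarrow> f v \<noteq> v"
  shows "bij_betw f S S" "sign_on S f = (-1) ^ (card S div 2)"
proof -
  define C where "C = (\<lambda>v. {v, f v}) ` S"
  have U: "\<Union>C = S" using assms(2) by (auto simp: C_def)
  have fin: "finite C" using assms(1) by (simp add: C_def)
  have block: "\<exists>v\<in>S. B = {v, f v} \<and> v \<noteq> f v \<and> f (f v) = v" if "B \<in> C" for B
    using that assms(3,4) unfolding C_def by force
  have "B = {u, f u}" if "B \<in> C" "u \<in> B" for B u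
    using block[OF that(1)] that(2) by (metis insert_commute insertE singletonD)
  then have disj: "pairwise disjnt C"
    unfolding pairwise_def disjnt_iff by metis
  have cyc: "\<exists>cs. set cs = B \<and> distinct cs \<and> cs \<noteq> [] \<and> even (length cs) \<and>
      (\<forall>u\<in>B. f u = cycle_of_list cs u)" if B: "B \<in> C" for B
  proof -
    obtain v where "B = {v, f v}" "v \<noteq> f v" "f (f v) = v" using block[OF B] by blast
    then show ?thesis by (intro exI[of _ "[v, f v]"]) auto
  qed
  have "card (\<Union>C) = (\<Sum>B\<in>C. card B)"
    using disj block by (intro card_Union_disjoint) fastforce+
  also have "\<dots> = (\<Sum>B\<in>C. 2)"
    by (intro sum.cong refl) (use block in fastforce)
  finally have "card C = card S div 2" by (simp add: U)
  with sign_on_even_cycles[OF fin disj cyc] show "bij_betw f S S" "sign_on S f = (-1) ^ (card S div 2)"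
    by (simp_all only: U)
qed

section \<open>Walks along the boundary of a face\<close>

lemma face_edges_rev_subset: "face_edges f \<subseteq> face_edges (rev f)"
proof -
  have "\<forall>i<length (rev f). {rev f ! i, rev f ! ((i + 1) mod length (rev f))} \<in> face_edges (rev f)"
    unfolding face_edges_def by blast
  then have "\<forall>i<length (rev (rev f)).
      {rev (rev f) ! i, rev (rev f) ! ((i + 1) mod length (rev (rev f)))} \<in> face_edges (rev f)"
    by (rule cyclic_successively_rev) (simp add: insert_commute)
  then show ?thesis unfolding face_edges_def[of f] by auto
qed

text \<open>At each vertex the walk can go only forward or backward along the face. A backward step
  straight after a forward one is a return, which is excluded.\<close>

lemma edge_step_forward:
  assumes "distinct f" "i < length f" "p (f ! i) = f ! (Suc i mod length f)"
    and edge: "\<And>v. v \<in> set f \<Longrightarrow> {v, p v} \<in> face_edges f"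
    and no_return: "\<And>v. v \<in> set f \<Longrightarrow> p (p v) \<noteq> v"
  shows "p (f ! (Suc i mod length f)) = f ! (Suc (Suc i mod length f) mod length f)"
proof -
  let ?n = "length f" and ?s = "Suc i mod length f"
  have s: "?s < ?n" using assms(2) by (intro mod_less_divisor) linarith
  obtain j where j: "j < ?n" "{f ! ?s, p (f ! ?s)} = {f ! j, f ! (Suc j mod ?n)}"
    using edge[of "f ! ?s"] s unfolding face_edges_def by auto
  have sj: "Suc j mod ?n < ?n" using assms(2) by (intro mod_less_divisor) linarith
  from j(2) show ?thesis unfolding doubleton_eq_iff
  proof (elim disjE conjE)
    assume "f ! ?s = f ! j" "p (f ! ?s) = f ! (Suc j mod ?n)"
    then show ?thesis using s j(1) assms(1) by (simp add: nth_eq_iff_index_eq)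
  next
    assume *: "f ! ?s = f ! (Suc j mod ?n)" "p (f ! ?s) = f ! j"
    then have "?s = Suc j mod ?n" using s sj assms(1) by (simp add: nth_eq_iff_index_eq)
    then have "i = j" using assms(2) j(1) by (auto simp: mod_Suc split: if_splits)
    then have "p (p (f ! i)) = f ! i" using * assms(3) by simp
    then show ?thesis using no_return assms(2) by simp
  qed
qed

lemma edge_steps_forward:
  assumes "distinct f" "i < length f" "p (f ! i) = f ! (Suc i mod length f)"
    and edge: "\<And>v. v \<in> set f \<Longrightarrow> {v, p v} \<in> face_edges f"
    and no_return: "\<And>v. v \<in> set f \<Longrightarrow> p (p v) \<noteq> v"
    and "v \<in> set f"
  shows "p v = cycle_of_list f v"
proof -
  let ?n = "length f"
  have n: "0 < ?n" using assms(2) by linarith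
  have *: "p (f ! ((i + k) mod ?n)) = f ! (Suc ((i + k) mod ?n) mod ?n)" for k
  proof (induction k)
    case 0
    then show ?case using assms(2,3) by simp
  next
    case (Suc k)
    have "(i + k) mod ?n < ?n" using n by simp
    from edge_step_forward[OF assms(1) this Suc edge no_return] show ?case
      by (simp add: mod_Suc_eq)
  qed
  obtain j where j: "j < ?n" "v = f ! j" using assms(6) by (auto simp: in_set_conv_nth)
  \<comment> \<open>Every index is reached from \<open>i\<close>: this number of forward steps leads
    once past the end of the list and on to \<open>j\<close>.\<close>
  have "(i + (?n - i + j)) mod ?n = j" using j(1) assms(2) by simp
  with *[of "?n - i + j"] show ?thesis using j assms(1) by (simp add: cycle_of_list_nth)
qed

text \<open>The step at \<open>f ! 0\<close> fixes the direction for the whole face. A backward step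
  is a forward step along \<open>rev f\<close>, where \<open>f ! 0\<close> is the last
  entry.\<close>

lemma edge_steps_cycle:
  assumes "distinct f" "f \<noteq> []"
    and edge: "\<And>v. v \<in> set f \<Longrightarrow> {v, p v} \<in> face_edges f"
    and no_return: "\<And>v. v \<in> set f \<Longrightarrow> p (p v) \<noteq> v"
  shows "(\<forall>v\<in>set f. p v = cycle_of_list f v) \<or> (\<forall>v\<in>set f. p v = cycle_of_list (rev f) v)"
proof -
  let ?n = "length f"
  have n: "0 < ?n" using assms(2) by simp
  obtain j where j: "j < ?n" "{f ! 0, p (f ! 0)} = {f ! j, f ! (Suc j mod ?n)}"
    using edge[of "f ! 0"] n unfolding face_edges_def by auto
  have sj: "Suc j mod ?n < ?n" using n by (intro mod_less_divisor)
  from j(2) show ?thesis unfolding doubleton_eq_iff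
  proof (elim disjE conjE)
    assume "f ! 0 = f ! j" "p (f ! 0) = f ! (Suc j mod ?n)"
    moreover from this have "j = 0" using n j(1) assms(1) nth_eq_iff_index_eq by metis
    ultimately have "p (f ! 0) = f ! (Suc 0 mod ?n)" by simp
    from edge_steps_forward[OF assms(1) n this edge no_return] show ?thesis by blast
  next
    assume *: "f ! 0 = f ! (Suc j mod ?n)" "p (f ! 0) = f ! j"
    then have "Suc j mod ?n = 0" using n sj assms(1) nth_eq_iff_index_eq by metis
    then have jn: "Suc j = ?n" using j(1) by (auto simp: mod_Suc split: if_splits)
    have "rev f ! j = f ! 0" "rev f ! 0 = f ! j" using jn n rev_nth[of j f] rev_nth[of 0 f] j(1)
      by (auto simp flip: jn length_greater_0_conv)
    then have "p (rev f ! j) = rev f ! (Suc j mod length (rev f))" using *(2) jn by simp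
    moreover have "{v, p v} \<in> face_edges (rev f)" if "v \<in> set (rev f)" for v
      using edge[of v] that face_edges_rev_subset by auto
    ultimately have "\<forall>v\<in>set f. p v = cycle_of_list (rev f) v"
      using edge_steps_forward[of "rev f" j p] assms(1) j(1) no_return by simp
    then show ?thesis ..
  qed
qed

section \<open>The type (3,3,3,3,8)\<close>

text \<open>\<open>adj\<close> holds for the ends of an octagon edge and \<open>tri\<close> for the corners of a triangle;
  \<open>octagon_star V adj tri v a x y z b\<close> lists the link of \<open>v\<close> from one octagon neighbour to the other.\<close>

definition octagon_star ::
  "'a set \<Rightarrow> ('a \<Rightarrow> 'a \<Rightarrow> bool) \<Rightarrow> ('a \<Rightarrow> 'a \<Rightarrow> 'a \<Rightarrow> bool) \<Rightarrow> 'a \<Rightarrow> 'a \<Rightarrow> 'a \<Rightarrow> 'a \<Rightarrow> 'a \<Rightarrow> 'a \<Rightarrow> bool"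
  where "octagon_star V adj tri v a x y z b \<longleftrightarrow>
    distinct [v, a, x, y, z, b] \<and> {a, x, y, z, b} \<subseteq> V \<and>
    (\<forall>u. adj v u \<longleftrightarrow> u = a \<or> u = b) \<and>
    (\<forall>p q. tri v p q \<longleftrightarrow> {p, q} \<in> {{a, x}, {x, y}, {y, z}, {z, b}})"

text \<open>Only octagon edges and triangles matter for the sign argument, so faces are replaced by
  two relations. The assumption \<open>card_adj\<close> expresses that the octagons partition the
  vertices: an 8-cycle has as many edges as vertices.\<close>

locale snub_star =
  fixes V :: "'a set" and adj :: "'a \<Rightarrow> 'a \<Rightarrow> bool" and tri :: "'a \<Rightarrow> 'a \<Rightarrow> 'a \<Rightarrow> bool"
  assumes finite_V: "finite V"
    and adj_V: "adj p q \<Longrightarrow> p \<in> V"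
    and adj_sym: "adj p q \<Longrightarrow> adj q p"
    and tri_sym: "tri p q r \<Longrightarrow> tri q p r" "tri p q r \<Longrightarrow> tri p r q"
    and star_exists: "v \<in> V \<Longrightarrow> \<exists>a x y z b. octagon_star V adj tri v a x y z b"
    and card_adj: "card {{p, q} |p q. adj p q} = card V"
begin

abbreviation "star \<equiv> octagon_star V adj tri"

definition "E = {{p, q} |p q. adj p q}"

lemma star_distinct: "star v a x y z b \<Longrightarrow> distinct [v, a, x, y, z, b]"
  and star_V: "star v a x y z b \<Longrightarrow> a \<in> V \<and> x \<in> V \<and> y \<in> V \<and> z \<in> V \<and> b \<in> V"
  and star_adj: "star v a x y z b \<Longrightarrow> adj v u \<longleftrightarrow> u = a \<or> u = b"
  and star_tri: "star v a x y z b \<Longrightarrow> tri v p q \<longleftrightarrow>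
    p = a \<and> q = x \<or> p = x \<and> q = a \<or> p = x \<and> q = y \<or> p = y \<and> q = x \<or>
    p = y \<and> q = z \<or> p = z \<and> q = y \<or> p = z \<and> q = b \<or> p = b \<and> q = z"
  unfolding octagon_star_def by (auto simp: doubleton_eq_iff)

lemma star_rev: "star v a x y z b \<Longrightarrow> star v b z y x a"
  unfolding octagon_star_def by (auto simp: doubleton_eq_iff)

lemma tri_V:
  assumes "v \<in> V" "tri v p q"
  shows "p \<in> V" "q \<in> V" "p \<noteq> q" "p \<noteq> v" "q \<noteq> v"
proof -
  obtain a x y z b where s: "star v a x y z b" using star_exists assms by blast
  show "p \<in> V" "q \<in> V" "p \<noteq> q" "p \<noteq> v" "q \<noteq> v"
    using star_tri[OF s, of p q] star_V[OF s] star_distinct[OF s] assms(2) by auto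
qed

text \<open>The octagon neighbours of \<open>v\<close> are the two ends of the path
  \<open>a\<close>, \<open>x\<close>, \<open>y\<close>, \<open>z\<close>, \<open>b\<close>, and no
  triangle at \<open>v\<close> joins them.\<close>

lemma one_adj:
  assumes "v \<in> V" "tri v p q" "adj v p"
  shows "\<not> adj v q"
proof -
  obtain a x y z b where s: "star v a x y z b" using star_exists assms by blast
  show ?thesis
    using star_tri[OF s, of p q] star_adj[OF s] star_distinct[OF s] assms(2,3) by auto
qed

lemma adj_triangle_exists:
  assumes "adj p q"
  shows "\<exists>w. tri p q w"
proof -
  obtain a x y z b where s: "star p a x y z b" using star_exists adj_V assms by blast
  show ?thesis using star_tri[OF s] star_adj[OF s] assms by blast
qed

lemma adj_triangle_unique:
  assumes "adj p q" "tri p q w" "tri p q w'"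
  shows "w = w'"
proof -
  obtain a x y z b where s: "star p a x y z b" using star_exists adj_V assms by blast
  show ?thesis
    using star_tri[OF s, of q w] star_tri[OF s, of q w'] star_adj[OF s] star_distinct[OF s] assms
    by auto
qed

text \<open>By \<open>one_adj\<close> at \<open>p\<close> and at \<open>q\<close>, a triangle with
  octagon edge \<open>{p, q}\<close> has no other octagon edge. So it avoids both octagon neighbours
  of \<open>v\<close> and is one of the two middle triangles.\<close>

lemma opposite_edge_cases:
  assumes "star v a x y z b" "v \<in> V" "adj p q" "tri v p q"
  shows "{p, q} = {x, y} \<or> {p, q} = {y, z}"
proof -
  have "\<not> adj v p" "\<not> adj v q"
    using assms one_adj tri_sym adj_sym adj_V by metis+
  then show ?thesis using star_tri[OF assms(1), of p q] star_adj[OF assms(1)] assms(4) by auto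
qed

text \<open>If both middle triangles at \<open>v\<close> stood on octagon edges, those edges would be the two octagon
  edges at \<open>y\<close>, and the link of \<open>y\<close> would close up after two triangles.\<close>

lemma not_both_adj:
  assumes "star v a x y z b" "v \<in> V" "adj x y" "adj y z"
  shows False
proof -
  have d: "x \<noteq> z" using star_distinct[OF assms(1)] by auto
  have t: "tri y x v" "tri y z v" using star_tri[OF assms(1)] tri_sym by metis+
  have "y \<in> V" using assms(4) adj_V by blast
  then obtain a' x' y' z' b' where s: "star y a' x' y' z' b'" using star_exists by blast
  then show False
    using star_tri[OF s, of x v] star_tri[OF s, of z v] star_adj[OF s, of x] star_adj[OF s, of z]
      star_distinct[OF s] d t assms(3,4) adj_sym[of x y] by auto
qed

lemma opposite_edge_unique:
  assumes "v \<in> V" "adj p q" "tri v p q" "adj p' q'" "tri v p' q'"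
  shows "{p, q} = {p', q'}"
proof -
  obtain a x y z b where s: "star v a x y z b" using star_exists assms by blast
  have "{p, q} = {x, y} \<or> {p, q} = {y, z}" "{p', q'} = {x, y} \<or> {p', q'} = {y, z}"
    using opposite_edge_cases[OF s] assms by auto
  moreover have "\<not> (adj x y \<and> adj y z)" using not_both_adj[OF s assms(1)] by blast
  moreover have "adj x y" if "{p, q} = {x, y} \<or> {p', q'} = {x, y}"
    using that assms adj_sym unfolding doubleton_eq_iff by blast
  moreover have "adj y z" if "{p, q} = {y, z} \<or> {p', q'} = {y, z}"
    using that assms adj_sym unfolding doubleton_eq_iff by blast
  ultimately show ?thesis by metis
qed

text \<open>There are as many octagon edges as vertices, so the injection from octagon edges to
  the apices of their triangles is onto.\<close>

lemma opposite_edge_exists: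
  assumes "v \<in> V"
  shows "\<exists>p q. adj p q \<and> tri v p q"
proof -
  define apex where "apex e = (SOME w. \<exists>p q. e = {p, q} \<and> adj p q \<and> tri w p q)" for e
  have apex: "\<exists>p q. e = {p, q} \<and> adj p q \<and> tri (apex e) p q" if e: "e \<in> E" for e
  proof -
    obtain p q where pq: "e = {p, q}" "adj p q" using e by (auto simp: E_def)
    obtain w where "tri p q w" using adj_triangle_exists pq by blast
    then have "tri w p q" using tri_sym by blast
    then have "\<exists>w p q. e = {p, q} \<and> adj p q \<and> tri w p q" using pq by blast
    then show ?thesis unfolding apex_def by (rule someI_ex)
  qed
  have in_V: "apex e \<in> V" if e: "e \<in> E" for e
  proof -
    obtain p q where pq: "adj p q" "tri (apex e) p q" using apex[OF e] by blast
    then show ?thesis using tri_V(2)[of p q "apex e"] tri_sym adj_V by blast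
  qed
  have "inj_on apex E"
  proof (rule inj_onI)
    fix e e' assume "e \<in> E" "e' \<in> E" "apex e = apex e'"
    then show "e = e'" using apex[of e] apex[of e'] in_V opposite_edge_unique by metis
  qed
  then have "card (apex ` E) = card V" using card_adj by (simp add: card_image E_def)
  then have "apex ` E = V" using in_V finite_V by (intro card_subset_eq) auto
  then show ?thesis using assms apex by blast
qed

text \<open>Exactly one middle triangle stands on an octagon edge; reading the link in the other
  direction if necessary makes it the one on \<open>{x, y}\<close>. This fixes which octagon
  neighbour is called \<open>a\<close>.\<close>

lemma oriented_star_exists:
  assumes "v \<in> V"
  shows "\<exists>a x y z b. star v a x y z b \<and> adj x y \<and> \<not> adj y z"
proof -
  obtain a x y z b where s: "star v a x y z b" using star_exists assms by blast
  obtain p q where pq: "adj p q" "tri v p q" using opposite_edge_exists[OF assms] by blast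
  have "{p, q} = {x, y} \<or> {p, q} = {y, z}" using opposite_edge_cases[OF s assms pq] .
  then have "adj x y \<or> adj y z" using pq adj_sym unfolding doubleton_eq_iff by blast
  then show ?thesis using s star_rev[OF s] not_both_adj[OF s assms] adj_sym by metis
qed

lemma rotation_system:
  obtains a x y z b where "\<And>v. v \<in> V \<Longrightarrow> star v (a v) (x v) (y v) (z v) (b v)"
    "\<And>v. v \<in> V \<Longrightarrow> adj (x v) (y v)" "\<And>v. v \<in> V \<Longrightarrow> \<not> adj (y v) (z v)"
  using oriented_star_exists by metis

text \<open>The witness for \<open>\<nu>\<close> is \<open>a\<close>, while \<open>x\<close> plays
  the role of the involution \<epsilon> and \<open>y\<close> that of their composite. Since
  \<open>y\<close> has order dividing 3 it is even, so \<open>a\<close> and \<open>x\<close> have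
  the same sign.\<close>

lemma oriented_neighbours:
  obtains \<nu> where "\<And>v. v \<in> V \<Longrightarrow> adj v (\<nu> v)" "\<And>v. v \<in> V \<Longrightarrow> \<nu> (\<nu> v) \<noteq> v"
    "bij_betw \<nu> V V" "sign_on V \<nu> = (-1) ^ (card V div 2)"
proof -
  obtain a x y z b where s: "\<And>v. v \<in> V \<Longrightarrow> star v (a v) (x v) (y v) (z v) (b v)"
    and xy: "\<And>v. v \<in> V \<Longrightarrow> adj (x v) (y v)" and yz: "\<And>v. v \<in> V \<Longrightarrow> \<not> adj (y v) (z v)"
    using rotation_system by metis
  have d: "v \<noteq> a v" "v \<noteq> x v" "v \<noteq> y v" "v \<noteq> z v" "a v \<noteq> x v" "a v \<noteq> y v" "x v \<noteq> y v" "x v \<noteq> z v"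
    "y v \<noteq> z v" "a v \<noteq> z v" "b v \<noteq> x v" "b v \<noteq> y v" "b v \<noteq> z v" if "v \<in> V" for v
    using star_distinct[OF s[OF that]] by auto
  have inV: "a v \<in> V" "x v \<in> V" "y v \<in> V" "z v \<in> V" if "v \<in> V" for v
    using star_V[OF s[OF that]] by auto
  have t: "tri v (a v) (x v)" "tri v (x v) (y v)" "tri v (y v) (z v)" "adj v (a v)" if "v \<in> V" for v
    using star_tri[OF s[OF that]] star_adj[OF s[OF that]] by auto
  \<comment> \<open>Seen from \<open>x v\<close>, the octagon edge \<open>{v, a v}\<close> is the
    opposite one, so it equals \<open>{x (x v), y (x v)}\<close>. The triangle on \<open>v\<close>,
    \<open>x v\<close>, \<open>y v\<close> decides which end is which: \<open>y v\<close> is an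
    octagon neighbour of \<open>x v\<close>, and no octagon neighbour is next to the middle vertex
    of the link.\<close>
  have x_inv: "x (x v) = v \<and> a (x v) = y v" if v: "v \<in> V" for v
  proof -
    let ?w = "x v"
    have w: "?w \<in> V" using inV v by blast
    note sw = s[OF w]
    have t1: "tri ?w v (a v)" "tri ?w v (y v)" using t[OF v] tri_sym by metis+
    have e: "{x ?w, y ?w} = {v, a v}"
      using opposite_edge_unique[OF w xy[OF w] t(2)[OF w], of v "a v"] t[OF v] t1 by blast
    have wy: "y v = a ?w \<or> y v = b ?w" using star_adj[OF sw, of "y v"] xy[OF v] by blast
    show ?thesis
    proof (cases "x ?w = v")
      case True
      then have "y ?w = a v" using e d[OF v] unfolding doubleton_eq_iff by auto
      then show ?thesis using True star_tri[OF sw, of v "y v"] t1 d[OF v] d[OF w] wy by auto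
    next
      case False
      then have "y ?w = v" "x ?w = a v" using e unfolding doubleton_eq_iff by auto
      then show ?thesis using star_tri[OF sw, of v "y v"] t1 d[OF v] d[OF w] wy by auto
    qed
  qed
  have x_sign: "bij_betw x V V" "sign_on V x = (-1) ^ (card V div 2)"
    using sign_on_fixpoint_free_involution[OF finite_V, of x] inV(2) x_inv d(2) by metis+
  \<comment> \<open>An octagon edge carries only one triangle. If \<open>a\<close> swapped
    \<open>v\<close> and \<open>w\<close>, both would have the same apex under \<open>x\<close>,
    contrary to \<open>x\<close> being an involution.\<close>
  have edge_inj: "v = w" if "v \<in> V" "w \<in> V" "{v, a v} = {w, a w}" for v w
  proof (rule ccontr)
    assume "v \<noteq> w"
    then have "a v = w" "a w = v" using that(3) unfolding doubleton_eq_iff by auto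
    then have "tri v w (x v)" "tri v w (x w)" "adj v w"
      using t(1,4)[OF that(1)] tri_sym(1)[OF t(1)[OF that(2)]] by simp_all
    then have "x v = x w" using adj_triangle_unique by blast
    then show False using x_inv that \<open>v \<noteq> w\<close> by metis
  qed
  have aa: "a (a v) \<noteq> v" if "v \<in> V" for v
    using edge_inj[of v "a v"] that inV(1) d(1)[of v] by (metis insert_commute)
  \<comment> \<open>If \<open>v\<close> and \<open>w\<close> had the same image \<open>?u\<close>,
    they would be its two octagon neighbours, and \<open>a ?u\<close> would step back to one of
    them, contradicting \<open>aa\<close>.\<close>
  have "inj_on a V"
  proof (rule inj_onI, rule ccontr)
    fix v w assume vw: "v \<in> V" "w \<in> V" "a v = a w" "v \<noteq> w"
    let ?u = "a v"
    have u: "?u \<in> V" using inV vw by blast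
    have "adj ?u v" "adj ?u w" using t(4)[OF vw(1)] t(4)[OF vw(2)] vw(3) adj_sym by metis+
    then have "a ?u = v \<or> a ?u = w"
      using star_adj[OF s[OF u]] t(4)[OF u] vw(4) by metis
    then show False using aa vw by metis
  qed
  then have a_bij: "bij_betw a V V"
    using inV finite_V by (simp add: bij_betw_def endo_inj_surj image_subsetI)
  have phi: "(a \<circ> x) v = y v" if "v \<in> V" for v using x_inv that by simp
  have phi_bij: "bij_betw (a \<circ> x) V V" using x_sign(1) a_bij by (rule bij_betw_trans)
  then have y_inj: "v = w" if "v \<in> V" "w \<in> V" "y v = y w" for v w
    using that phi unfolding bij_betw_def inj_on_def by metis
  \<comment> \<open>Of the four triangles at \<open>w\<close>, the outer two have an octagon edge at
    \<open>w\<close> and the one on \<open>{x w, y w}\<close> stands on one, so only the triangle on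
    \<open>{y w, z w}\<close> has none.\<close>
  have rainbow: "{y w, z w} = {p, q}"
    if "w \<in> V" "tri w p q" "\<not> adj w p" "\<not> adj w q" "\<not> adj p q" for w p q
    using that star_tri[OF s[OF that(1)], of p q] star_adj[OF s[OF that(1)]] xy[OF that(1)]
      adj_sym[of q p] by auto
  \<comment> \<open>The triangle \<open>v\<close>, \<open>y v\<close>, \<open>z v\<close> has no
    octagon edge, so by \<open>rainbow\<close> it is the same triangle seen from each corner. Thus
    \<open>y\<close> sends each corner to a different corner, and injectivity makes it a
    3-cycle.\<close>
  have y3: "y (y (y v)) = v" if v: "v \<in> V" for v
  proof -
    let ?y = "y v" and ?z = "z v"
    have na: "\<not> adj v ?y" "\<not> adj v ?z" "\<not> adj ?y ?z"
      using star_adj[OF s[OF v]] d[OF v] yz[OF v] by auto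
    have "{y ?y, z ?y} = {v, ?z}" "{y ?z, z ?z} = {v, ?y}"
      using rainbow[OF inV(3)[OF v], of v ?z] rainbow[OF inV(4)[OF v], of v ?y] na adj_sym t(3)[OF v] tri_sym
      by blast+
    then have "y ?y = v \<or> y ?y = ?z" "y ?z = v \<or> y ?z = ?y" by (auto simp: doubleton_eq_iff)
    moreover have "y ?y \<noteq> y ?z" "y ?z \<noteq> y v" "y ?y \<noteq> y v"
      using y_inj[of ?y ?z] y_inj[of ?z v] y_inj[of ?y v] d[OF v] inV[OF v] v by auto
    ultimately show ?thesis by auto
  qed
  have "sign_on V ((a \<circ> x) \<circ> ((a \<circ> x) \<circ> (a \<circ> x))) = sign_on V id"
    using phi y3 inV by (intro sign_on_cong) auto
  moreover have "sign_on V ((a \<circ> x) \<circ> ((a \<circ> x) \<circ> (a \<circ> x))) =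
      sign_on V (a \<circ> x) * (sign_on V (a \<circ> x) * sign_on V (a \<circ> x))"
    using phi_bij finite_V by (simp add: sign_on_compose bij_betw_trans del: o_apply)
  ultimately have "sign_on V (a \<circ> x) = 1" by (simp add: sign_on_def)
  then have "sign_on V a * sign_on V x = 1"
    using sign_on_compose[OF a_bij x_sign(1) finite_V] by simp
  then have "sign_on V a = sign_on V x"
    by (metis mult.right_neutral mult.commute sign_left_idempotent sign_on_def)
  then show thesis using that[of a] t(4) aa a_bij x_sign(2) by metis
qed

end

section \<open>From the map to its vertex links, and the sign contradiction\<close>

lemma no_semi_equivelar_3_3_3_3_8:
  fixes M :: "'a list set"
  assumes "euler_char M = -1"
  shows "\<not> semi_equivelar [3,3,3,3,8] M"
proof
  assume "semi_equivelar [3,3,3,3,8] M"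
  then interpret semi_equivelar_map "[3,3,3,3,8]" M by unfold_locales
  have c: "card V = 24" "card (polygons 8) = 3"
    using card_polygons[of 3] card_polygons[of 8] card_faces card_edges
      assms[unfolded euler_char_def] by simp_all
  have oct: "f \<in> M" "length f = 8" "distinct f" "set f \<subseteq> V" if "f \<in> polygons 8" for f
    using that face face_in_verts by (auto simp: polygons_def)
  have oct_unique: "f = g" if "f \<in> polygons 8" "g \<in> polygons 8" "v \<in> set f" "v \<in> set g" for f g v
  proof -
    have "v \<in> V" using oct(4) that by blast
    then have "card {f \<in> polygons 8. v \<in> set f} = 1" using card_polygons_at_vertex[of v 8] by simp
    then obtain h where "{f \<in> polygons 8. v \<in> set f} = {h}" by (auto simp: card_1_singleton_iff)
    moreover have "f \<in> {f \<in> polygons 8. v \<in> set f}" "g \<in> {f \<in> polygons 8. v \<in> set f}"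
      using that by auto
    ultimately show ?thesis by (metis singletonD)
  qed
  have oct_cover: "\<Union>(set ` polygons 8) = V"
  proof (rule equalityI; rule subsetI)
    fix v assume "v \<in> V"
    then obtain f where "f \<in> polygons 8" "v \<in> set f" by (rule polygon_at_vertex[of _ 8]) auto
    then show "v \<in> \<Union>(set ` polygons 8)" by blast
  qed (use oct(4) in blast)
  have edge_oct: "p \<in> set f" "q \<in> set f" "p \<noteq> q" if "f \<in> M" "{p, q} \<in> face_edges f" for f p q
    using face_edges_card[of f "{p, q}"] face that by (auto simp: card_insert_if split: if_splits)

  define adj where "adj p q \<longleftrightarrow> (\<exists>f\<in>polygons 8. {p, q} \<in> face_edges f)" for p q
  define tri where "tri p q r \<longleftrightarrow> distinct [p, q, r] \<and> (\<exists>f\<in>polygons 3. set f = {p, q, r})" for p q r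

  have star: "\<exists>a x y z b. octagon_star V adj tri v a x y z b" if v: "v \<in> V" for v
  proof -
    obtain fs where fs: "face_cycle M v fs" "map length fs = [3,3,3,3,8]" using vertex_cycle[OF v] .
    then obtain t1 t2 t3 t4 f where fs_eq: "fs = [t1, t2, t3, t4, f]"
      and len: "length t1 = 3" "length t2 = 3" "length t3 = 3" "length t4 = 3" "length f = 8"
      by (auto simp: map_eq_Cons_conv)
    have df: "distinct [t1, t2, t3, t4, f]" and at_v: "{g \<in> M. v \<in> set g} = {t1, t2, t3, t4, f}"
      and ex: "\<And>i. i < 5 \<Longrightarrow> \<exists>u. {v, u} \<in> face_edges (fs ! i) \<inter> face_edges (fs ! ((i + 1) mod 5))"
      using fs(1) unfolding face_cycle_def fs_eq by auto
    \<comment> \<open>The link of \<open>v\<close> consists of the far ends of the edges shared by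
      consecutive faces of the cycle. Should two of them coincide, one edge would lie in three
      faces.\<close>
    obtain x where x: "{v, x} \<in> face_edges t1" "{v, x} \<in> face_edges t2" using ex[of 0] by (auto simp: fs_eq)
    obtain y where y: "{v, y} \<in> face_edges t2" "{v, y} \<in> face_edges t3" using ex[of 1] by (auto simp: fs_eq numeral_2_eq_2)
    obtain z where z: "{v, z} \<in> face_edges t3" "{v, z} \<in> face_edges t4" using ex[of 2] by (auto simp: fs_eq)
    obtain b where b: "{v, b} \<in> face_edges t4" "{v, b} \<in> face_edges f" using ex[of 3] by (auto simp: fs_eq)
    obtain a where a: "{v, a} \<in> face_edges f" "{v, a} \<in> face_edges t1" using ex[of 4] by (auto simp: fs_eq)
    have inM: "t1 \<in> M" "t2 \<in> M" "t3 \<in> M" "t4 \<in> M" "f \<in> M"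
      and vin: "v \<in> set t1" "v \<in> set t2" "v \<in> set t3" "v \<in> set t4" "v \<in> set f" using at_v by auto
    have two: False if "g1 \<in> M" "g2 \<in> M" "g3 \<in> M" "e \<in> face_edges g1" "e \<in> face_edges g2" "e \<in> face_edges g3"
      "distinct [g1, g2, g3]" for g1 g2 g3 e
      using edge_two_faces[of g1 g2 g3 e] that by auto
    have "x \<noteq> y" using two[of t1 t2 t3 "{v, x}"] x y inM df by auto
    moreover have "x \<noteq> z" using two[of t1 t2 t3 "{v, x}"] x z inM df by auto
    moreover have "x \<noteq> b" using two[of t1 t2 t4 "{v, x}"] x b inM df by auto
    moreover have "x \<noteq> a" using two[of t1 t2 f "{v, x}"] x a inM df by auto
    moreover have "y \<noteq> z" using two[of t2 t3 t4 "{v, y}"] y z inM df by auto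
    moreover have "y \<noteq> b" using two[of t2 t3 t4 "{v, y}"] y b inM df by auto
    moreover have "y \<noteq> a" using two[of t2 t3 f "{v, y}"] y a inM df by auto
    moreover have "z \<noteq> b" using two[of t3 t4 f "{v, z}"] z b inM df by auto
    moreover have "z \<noteq> a" using two[of t3 t4 f "{v, z}"] z a inM df by auto
    moreover have "b \<noteq> a" using two[of t4 f t1 "{v, b}"] b a inM df by auto
    moreover have "v \<noteq> x" "v \<noteq> y" "v \<noteq> z" "v \<noteq> b" "v \<noteq> a"
      using edge_oct(3) x y z a b inM by metis+
    ultimately have dist: "distinct [v, a, x, y, z, b]" by auto
    have tri_set: "set t = {v, p, q}"
      if "t \<in> M" "length t = 3" "{v, p} \<in> face_edges t" "{v, q} \<in> face_edges t" "p \<noteq> q" for t p q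
    proof (rule sym, rule card_subset_eq)
      show "{v, p, q} \<subseteq> set t" using edge_oct that by blast
      have "v \<noteq> p" "v \<noteq> q" using edge_oct that by blast+
      then show "card {v, p, q} = card (set t)" using that face(1) by (simp add: distinct_card)
    qed simp
    have sets: "set t1 = {v, a, x}" "set t2 = {v, x, y}" "set t3 = {v, y, z}" "set t4 = {v, z, b}"
      using tri_set len inM a x y z b dist by auto
    have "adj v u \<longleftrightarrow> u = a \<or> u = b" for u
    proof -
      have "adj v u \<longleftrightarrow> {v, u} \<in> face_edges f"
      proof
        assume "adj v u"
        then obtain g where "g \<in> polygons 8" "{v, u} \<in> face_edges g" unfolding adj_def by blast
        moreover have "f \<in> polygons 8" using inM len by (simp add: polygons_def)
        ultimately show "{v, u} \<in> face_edges f" using oct_unique[of f g v] edge_oct oct vin by blast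
      next
        assume "{v, u} \<in> face_edges f"
        then show "adj v u" using inM len unfolding adj_def polygons_def by blast
      qed
      moreover obtain p q where "\<And>u. {v, u} \<in> face_edges f \<longleftrightarrow> u = p \<or> u = q"
        using face_edges_neighbours[of f v] face inM vin by metis
      ultimately show ?thesis using a(1) b(2) \<open>b \<noteq> a\<close> by metis
    qed
    moreover have "tri v p q \<longleftrightarrow> {p, q} \<in> {{a, x}, {x, y}, {y, z}, {z, b}}" for p q
    proof
      assume "tri v p q"
      then obtain g where g: "g \<in> polygons 3" "set g = {v, p, q}" "distinct [v, p, q]" unfolding tri_def by blast
      then have "g \<in> {g \<in> M. v \<in> set g}" "g \<noteq> f" using len by (auto simp: polygons_def)
      then have "g \<in> {t1, t2, t3, t4}" unfolding at_v by blast
      \<comment> \<open>Deleting \<open>v\<close> turns each triangle at \<open>v\<close> into its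
        edge of the link.\<close>
      then have "set g - {v} \<in> (\<lambda>t. set t - {v}) ` {t1, t2, t3, t4}" by (rule imageI)
      moreover have "set g - {v} = {p, q}" using g(2,3) by auto
      moreover have "set t1 - {v} = {a, x}" "set t2 - {v} = {x, y}" "set t3 - {v} = {y, z}" "set t4 - {v} = {z, b}"
        unfolding sets using dist by auto
      ultimately show "{p, q} \<in> {{a, x}, {x, y}, {y, z}, {z, b}}"
        by (simp only: image_insert image_empty)
    next
      assume "{p, q} \<in> {{a, x}, {x, y}, {y, z}, {z, b}}"
      then have "distinct [v, p, q]" using dist by (auto simp: doubleton_eq_iff)
      moreover have "insert v {p, q} \<in> insert v ` {{a, x}, {x, y}, {y, z}, {z, b}}"
        using \<open>{p, q} \<in> _\<close> by (rule imageI)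
      then have "{v, p, q} \<in> set ` {t1, t2, t3, t4}" by (simp only: sets image_insert image_empty)
      then have "\<exists>g\<in>polygons 3. set g = {v, p, q}" using inM len unfolding polygons_def by blast
      ultimately show "tri v p q" unfolding tri_def by blast
    qed
    moreover have "{a, x, y, z, b} \<subseteq> V" 
      using face_in_verts[OF inM(1)] face_in_verts[OF inM(3)] face_in_verts[OF inM(4)] unfolding sets by auto
    ultimately show ?thesis using dist unfolding octagon_star_def by blast
  qed

  have E: "{{p, q} |p q. adj p q} = (\<Union>f\<in>polygons 8. face_edges f)"
    unfolding adj_def face_edges_def by blast
  have "card (\<Union>f\<in>polygons 8. face_edges f) = (\<Sum>f\<in>polygons 8. card (face_edges f))"
  proof (rule card_UN_disjoint)
    show "finite (polygons 8)" by (rule finite_polygons)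
    show "\<forall>f\<in>polygons 8. finite (face_edges f)" unfolding face_edges_def by simp
    show "\<forall>f\<in>polygons 8. \<forall>g\<in>polygons 8. f \<noteq> g \<longrightarrow> face_edges f \<inter> face_edges g = {}"
    proof (intro ballI impI equals0I)
      fix f g e assume fg: "f \<in> polygons 8" "g \<in> polygons 8" "f \<noteq> g" "e \<in> face_edges f \<inter> face_edges g"
      then have "e \<subseteq> set f" "e \<subseteq> set g" "card e = 2"
        using face_edges_card[of f e] face_edges_card[of g e] oct face by auto
      moreover from this obtain v where "v \<in> e" by fastforce
      ultimately show False using oct_unique fg(1-3) by blast
    qed
  qed
  also have "\<dots> = (\<Sum>f\<in>polygons 8. 8)"
    by (intro sum.cong refl) (simp add: oct card_face_edges)
  finally have card_E: "card {{p, q} |p q. adj p q} = card V" using c by (simp add: E)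

  interpret snub_star V adj tri
  proof
    show "finite V" by (rule finite_verts)
    show "p \<in> V" if "adj p q" for p q using that edge_oct(1) oct unfolding adj_def by blast
    show "adj q p" if "adj p q" for p q using that unfolding adj_def by (simp add: insert_commute)
    show "tri q p r" "tri p r q" if "tri p q r" for p q r
      using that unfolding tri_def by (auto simp: insert_commute)
    show "\<exists>a x y z b. octagon_star V adj tri v a x y z b" if "v \<in> V" for v using star that .
    show "card {{p, q} |p q. adj p q} = card V" by (rule card_E)
  qed
  obtain \<nu> where \<nu>: "\<And>v. v \<in> V \<Longrightarrow> adj v (\<nu> v)" "\<And>v. v \<in> V \<Longrightarrow> \<nu> (\<nu> v) \<noteq> v"
    and sign1: "sign_on V \<nu> = (-1) ^ (card V div 2)"
    by (rule oriented_neighbours) blast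
  \<comment> \<open>The second computation of the sign: without returns, \<open>\<nu>\<close> runs
    once around each octagon in one of its two directions. The blocks are vertex sets, so
    injectivity of \<open>set\<close> on octagons is needed to count 3 of them.\<close>
  have "sign_on (\<Union>(set ` polygons 8)) \<nu> = (-1) ^ card (set ` polygons 8)"
  proof (rule sign_on_even_cycles)
    show "finite (set ` polygons 8)" using finite_polygons by simp
    show "pairwise disjnt (set ` polygons 8)"
      using oct_unique unfolding pairwise_def disjnt_iff by blast
    fix B assume "B \<in> set ` polygons 8"
    then obtain f where f: "f \<in> polygons 8" "B = set f" by blast
    have "{v, \<nu> v} \<in> face_edges f" if v: "v \<in> set f" for v
    proof -
      have "adj v (\<nu> v)" using v \<nu>(1) oct(4)[OF f(1)] by blast
      then obtain g where "g \<in> polygons 8" "{v, \<nu> v} \<in> face_edges g" unfolding adj_def by blast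
      then show ?thesis using oct_unique[of f g v] edge_oct(1) oct f v by metis
    qed
    moreover have "f \<noteq> []" using oct[OF f(1)] by auto
    ultimately have "(\<forall>v\<in>set f. \<nu> v = cycle_of_list f v) \<or> (\<forall>v\<in>set f. \<nu> v = cycle_of_list (rev f) v)"
      using \<nu>(2) oct[OF f(1)] by (intro edge_steps_cycle) auto
    then have "\<exists>cs\<in>{f, rev f}. \<forall>v\<in>set f. \<nu> v = cycle_of_list cs v" by blast
    moreover have "set cs = B \<and> distinct cs \<and> cs \<noteq> [] \<and> even (length cs)" if "cs \<in> {f, rev f}" for cs
      using that oct[OF f(1)] f(2) \<open>f \<noteq> []\<close> by auto
    ultimately show "\<exists>cs. set cs = B \<and> distinct cs \<and> cs \<noteq> [] \<and> even (length cs) \<and>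
        (\<forall>v\<in>B. \<nu> v = cycle_of_list cs v)" using f(2) by blast
  qed
  moreover have "inj_on set (polygons 8)"
  proof (rule inj_onI)
    fix f g assume fg: "f \<in> polygons 8" "g \<in> polygons 8" "set f = set g"
    then have "hd f \<in> set f" using oct[OF fg(1)] by (intro hd_in_set) auto
    then show "f = g" using oct_unique[OF fg(1,2)] fg(3) by blast
  qed
  ultimately have "sign_on V \<nu> = -1" using c by (simp add: oct_cover card_image)
  \<comment> \<open>The links gave the sign 1, since 24 div 2 is even.\<close>
  then show False using sign1 c by simp
qed

theorem theorem2:
  fixes M :: "'a list set"
  assumes "euler_char M = -1"
  shows "\<not> semi_equivelar [3,3,3,3,8] M \<and> \<not> semi_equivelar [3,3,4,3,6] M \<and>
         \<not> semi_equivelar [3,6,4,6] M \<and> \<not> semi_equivelar [4,4,4,6] M \<and>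
         \<not> semi_equivelar [4,8,12] M"
  using assms no_semi_equivelar_3_3_3_3_8 no_semi_equivelar_3_3_4_3_6 no_semi_equivelar_3_6_4_6
    no_semi_equivelar_4_4_4_6 no_semi_equivelar_4_8_12 by blast

end
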